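(* Let $\mathcal{S}=\langle\mathcal{L},\vdash_\gamma\rangle$ and $\mathcal{T}=\langle\mathcal{L}',\vdash_\delta\rangle$ be two deductive systems with domains $S$ and $T$, and let $\gamma,\delta$ be the structural closure operators associated to $\vdash_\gamma$ and $\vdash_\delta$ respectively, both assumed different from the identity map. Then: (i) $\mathcal{S}$ is non-structurally non-conservatively interpretable in $\mathcal{T}$ if and only if there exists a sup-lattice homomorphism $f:\wp(\mathbf{S})_\gamma\to\wp(\mathbf{T})_\delta$; (ii) $\mathcal{S}$ is non-structurally weakly interpretable in $\mathcal{T}$ if and only if there exist a $\wp(\mathbf{\Sigma}_{\mathcal{L}'})$-module structural closure operator $\varepsilon\ge\delta$ on $\wp(\mathbf{T})$ and an injective homomorphism of sup-lattices $f:\wp(\mathbf{S})_\gamma\to\wp(\mathbf{T})_\varepsilon$; (iii) $\mathcal{S}$ and $\mathcal{T}$ are non-structurally equivalent if and only if there exists an isomorphism of sup-lattices $f:\wp(\mathbf{S})_\gamma\to\wp(\mathbf{T})_\delta$.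
   Context: A propositional language is $\mathcal{L}=\langle L,\nu\rangle$ with $L$ a set of connectives and $\nu:L\to\mathbb{N}_0$ the arity; formulas are built over a denumerable set of variables; substitutions are maps from variables to formulas, extended to formulas; $\mathbf{\Sigma}_{\mathcal{L}}$ is the monoid of substitutions and $\wp(\mathbf{\Sigma}_{\mathcal{L}})$ the quantale of sets of substitutions (union, complex product, unit $\{\mathrm{id}\}$). A sequent of type $(m,n)$ over $\mathcal{L}$ is a pair of sequences of $\mathcal{L}$-formulas of lengths $m$ and $n$ (not both zero). A deductive system $\mathcal{S}=\langle\mathcal{L},\vdash_\gamma\rangle$ has as domain a set $S$ of sequents over $\mathcal{L}$ closed under type (containing all sequents of each type it contains; formulas are $(0,1)$-sequents and equations $(1,1)$-sequents), with a finitary, substitution-invariant consequence relation $\vdash_\gamma$ on $\wp(S)$: $\Psi\subseteq\Phi$ implies $\Phi\vdash\Psi$; $\vdash$ is transitive; $\Phi\vdash\bigcup_{\Phi\vdash\Psi}\Psi$; if $\Phi\vdash\Psi$ with $\Psi$ finite then $\Phi_0\vdash\Psi$ for some finite $\Phi_0\subseteq\Phi$; $\Phi\vdash\Psi$ implies $\sigma[\Phi]\vdash\sigma[\Psi]$ for each substitution $\sigma$. The associated closure operator is $\gamma(\Phi)=\bigcup\{\Psi\mid\Phi\vdash_\gamma\Psi\}$. $\wp(\mathbf{S})$ is the $\wp(\mathbf{\Sigma}_{\mathcal{L}})$-module of subsets of $S$ with $\Sigma\star\Phi=\{\sigma(\varphi)\mid\sigma\in\Sigma,\varphi\in\Phi\}$.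 A structural closure operator on it is an order preserving, extensive, idempotent map $\gamma$ with $\Sigma\star\gamma(\Phi)\subseteq\gamma(\Sigma\star\Phi)$; operators are compared pointwise. $\wp(\mathbf{S})_\gamma$ is the sup-lattice $\{\gamma(\Phi)\mid\Phi\subseteq S\}$ with join $\gamma(\bigcup_i\Phi_i)$. Sup-lattice homomorphisms preserve arbitrary joins. Definitions. A non-structural interpretation of $\mathcal{S}$ in $\mathcal{T}$ is a residuated (i.e. arbitrary-union-preserving) map $\iota:\wp(S)\to\wp(T)$ such that for all $\Phi,\Psi\in\wp(S)$, $\Phi\vdash_\gamma\Psi$ iff $\iota(\Phi)\vdash_\delta\iota(\Psi)$. A non-structural non-conservative interpretation is a residuated map $\iota:\wp(S)\to\wp(T)$ such that $\Phi\vdash_\gamma\Psi$ implies $\iota(\Phi)\vdash_\delta\iota(\Psi)$. A non-structural weak interpretation of $\mathcal{S}$ in $\mathcal{T}$ is a map $\iota$ for which there exists a non-contradictory extension $\vdash_\varepsilon$ of $\vdash_\delta$ (a consequence relation stronger than $\vdash_\delta$ under which not everything is derivable) such that $\iota$ is a non-structural interpretation of $\mathcal{S}$ in $\mathcal{T}'=\langle\mathcal{L}',\vdash_\varepsilon\rangle$. $\mathcal{S}$ and $\mathcal{T}$ are non-structurally equivalent (similar) if there exist a non-structural interpretation $\iota$ of $\mathcal{S}$ in $\mathcal{T}$ and a non-structural interpretation $\iota'$ of $\mathcal{T}$ in $\mathcal{S}$ such that $\Phi\vdash_\gamma(\iota'\circ\iota)(\Phi)$ and $(\iota'\circ\iota)(\Phi)\vdash_\gamma\Phi$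 for all $\Phi\subseteq S$.
   Formalization: Part (ii) is stated only when the two systems are not both contradictory (everything derivable from everything), where it fails as written; the extension in a weak interpretation is taken substitution-invariant but not necessarily finitary, matching the arbitrary structural closure operator ε. *)

theory Defs
  imports Main "HOL-Library.FuncSet"
begin

record 'c lang =
  conns :: "'c set"
  arity :: "'c \<Rightarrow> nat"

text \<open>The set of connectives of a language may be empty, so it is a set and not a type.
  Raw terms are freely generated; \<open>formulas L\<close> selects the formulas over \<open>L\<close>.\<close>

datatype 'c fm = Var nat | Con 'c "'c fm list"

inductive_set formulas :: "('c, 'z) lang_scheme \<Rightarrow> 'c fm set"
  for L :: "('c, 'z) lang_scheme" where
  Var: "Var n \<in> formulas L"
| Con: "\<lbrakk>c \<in> conns L; length as = arity L c; \<forall>a \<in> set as. a \<in> formulas L\<rbrakk>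
    \<Longrightarrow> Con c as \<in> formulas L"

definition substs :: "('c, 'z) lang_scheme \<Rightarrow> (nat \<Rightarrow> 'c fm) set" where
  "substs L = {\<sigma>. \<forall>n. \<sigma> n \<in> formulas L}"

primrec subst_fm :: "(nat \<Rightarrow> 'c fm) \<Rightarrow> 'c fm \<Rightarrow> 'c fm" where
  "subst_fm \<sigma> (Var n) = \<sigma> n"
| "subst_fm \<sigma> (Con c as) = Con c (map (subst_fm \<sigma>) as)"

type_synonym 'c sequent = "'c fm list \<times> 'c fm list"

definition seq_type :: "'c sequent \<Rightarrow> nat \<times> nat" where
  "seq_type s = (length (fst s), length (snd s))"

definition sequents :: "('c, 'z) lang_scheme \<Rightarrow> 'c sequent set" where
  "sequents L =
     {s. set (fst s) \<subseteq> formulas L \<and> set (snd s) \<subseteq> formulas L \<and> seq_type s \<noteq> (0, 0)}"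

definition subst_seq :: "(nat \<Rightarrow> 'c fm) \<Rightarrow> 'c sequent \<Rightarrow> 'c sequent" where
  "subst_seq \<sigma> s = (map (subst_fm \<sigma>) (fst s), map (subst_fm \<sigma>) (snd s))"

definition closed_under_type :: "('c, 'z) lang_scheme \<Rightarrow> 'c sequent set \<Rightarrow> bool" where
  "closed_under_type L D \<longleftrightarrow>
     (\<forall>s \<in> D. \<forall>s' \<in> sequents L. seq_type s' = seq_type s \<longrightarrow> s' \<in> D)"

definition consequence_relation :: "'c sequent set \<Rightarrow> ('c sequent set \<Rightarrow> 'c sequent set \<Rightarrow> bool) \<Rightarrow> bool" where
  "consequence_relation D R \<longleftrightarrow>
     (\<forall>\<Phi> \<Psi>. R \<Phi> \<Psi> \<longrightarrow> \<Phi> \<subseteq> D \<and> \<Psi> \<subseteq> D) \<and>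
     (\<forall>\<Phi> \<Psi>. \<Phi> \<subseteq> D \<longrightarrow> \<Psi> \<subseteq> \<Phi> \<longrightarrow> R \<Phi> \<Psi>) \<and>
     (\<forall>\<Phi> \<Psi> \<Xi>. R \<Phi> \<Psi> \<longrightarrow> R \<Psi> \<Xi> \<longrightarrow> R \<Phi> \<Xi>) \<and>
     (\<forall>\<Phi>. \<Phi> \<subseteq> D \<longrightarrow> R \<Phi> (\<Union>{\<Psi>. R \<Phi> \<Psi>}))"

definition finitary :: "('c sequent set \<Rightarrow> 'c sequent set \<Rightarrow> bool) \<Rightarrow> bool" where
  "finitary R \<longleftrightarrow>
     (\<forall>\<Phi> \<Psi>. R \<Phi> \<Psi> \<longrightarrow> finite \<Psi> \<longrightarrow> (\<exists>\<Phi>\<^sub>0. finite \<Phi>\<^sub>0 \<and> \<Phi>\<^sub>0 \<subseteq> \<Phi> \<and> R \<Phi>\<^sub>0 \<Psi>))"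

definition substitution_invariant ::
  "('c, 'z) lang_scheme \<Rightarrow> ('c sequent set \<Rightarrow> 'c sequent set \<Rightarrow> bool) \<Rightarrow> bool" where
  "substitution_invariant L R \<longleftrightarrow>
     (\<forall>\<sigma> \<in> substs L. \<forall>\<Phi> \<Psi>. R \<Phi> \<Psi> \<longrightarrow> R (subst_seq \<sigma> ` \<Phi>) (subst_seq \<sigma> ` \<Psi>))"

record 'c dsystem =
  language :: "'c lang"
  domain :: "'c sequent set"
  entails :: "'c sequent set \<Rightarrow> 'c sequent set \<Rightarrow> bool"

definition deductive_system :: "'c dsystem \<Rightarrow> bool" where
  "deductive_system S \<longleftrightarrow>
     domain S \<subseteq> sequents (language S) \<and>
     closed_under_type (language S) (domain S) \<and>
     consequence_relation (domain S) (entails S) \<and>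
     finitary (entails S) \<and>
     substitution_invariant (language S) (entails S)"

definition closure_op :: "'c dsystem \<Rightarrow> 'c sequent set \<Rightarrow> 'c sequent set" where
  "closure_op S \<Phi> = \<Union>{\<Psi>. entails S \<Phi> \<Psi>}"

text \<open>A contradictory system has a one-element lattice of theories. If it is the target of a
  weak interpretation there is no non-contradictory extension to interpret into, although a
  one-element lattice still embeds into a one-element lattice; so statements about weak
  interpretability must exclude the case that both systems are contradictory.\<close>

definition contradictory :: "'c dsystem \<Rightarrow> bool" where
  "contradictory S \<longleftrightarrow> (\<forall>\<Phi> \<Psi>. \<Phi> \<subseteq> domain S \<longrightarrow> \<Psi> \<subseteq> domain S \<longrightarrow> entails S \<Phi> \<Psi>)"

definition star :: "(nat \<Rightarrow> 'c fm) set \<Rightarrow> 'c sequent set \<Rightarrow> 'c sequent set" (infixr "\<star>" 75) where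
  "\<Sigma> \<star> \<Phi> = {subst_seq \<sigma> \<phi> | \<sigma> \<phi>. \<sigma> \<in> \<Sigma> \<and> \<phi> \<in> \<Phi>}"

text \<open>Operators on the powerset of \<open>D\<close> are total functions whose values outside that powerset are
  irrelevant.\<close>

definition structural_closure_operator ::
  "('c, 'z) lang_scheme \<Rightarrow> 'c sequent set \<Rightarrow> ('c sequent set \<Rightarrow> 'c sequent set) \<Rightarrow> bool" where
  "structural_closure_operator L D \<epsilon> \<longleftrightarrow>
     \<epsilon> \<in> Pow D \<rightarrow> Pow D \<and>
     (\<forall>\<Phi> \<Psi>. \<Psi> \<subseteq> D \<longrightarrow> \<Phi> \<subseteq> \<Psi> \<longrightarrow> \<epsilon> \<Phi> \<subseteq> \<epsilon> \<Psi>) \<and>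
     (\<forall>\<Phi> \<subseteq> D. \<Phi> \<subseteq> \<epsilon> \<Phi>) \<and>
     (\<forall>\<Phi> \<subseteq> D. \<epsilon> (\<epsilon> \<Phi>) = \<epsilon> \<Phi>) \<and>
     (\<forall>\<Sigma> \<subseteq> substs L. \<forall>\<Phi> \<subseteq> D. \<Sigma> \<star> \<epsilon> \<Phi> \<subseteq> \<epsilon> (\<Sigma> \<star> \<Phi>))"

text \<open>A sup-lattice is given by its carrier and its operation of arbitrary join; the order is the
  induced one.\<close>

record 'a sup_lattice =
  elems :: "'a set"
  Join :: "'a set \<Rightarrow> 'a"

definition sup_hom :: "'a sup_lattice \<Rightarrow> 'b sup_lattice \<Rightarrow> ('a \<Rightarrow> 'b) \<Rightarrow> bool" where
  "sup_hom A B f \<longleftrightarrow>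
     f \<in> elems A \<rightarrow> elems B \<and> (\<forall>X \<subseteq> elems A. f (Join A X) = Join B (f ` X))"

definition sup_iso :: "'a sup_lattice \<Rightarrow> 'b sup_lattice \<Rightarrow> ('a \<Rightarrow> 'b) \<Rightarrow> bool" where
  "sup_iso A B f \<longleftrightarrow> sup_hom A B f \<and> bij_betw f (elems A) (elems B)"

definition theories ::
  "'c sequent set \<Rightarrow> ('c sequent set \<Rightarrow> 'c sequent set) \<Rightarrow> 'c sequent set sup_lattice" where
  "theories D \<gamma> = \<lparr>elems = \<gamma> ` Pow D, Join = (\<lambda>X. \<gamma> (\<Union>X))\<rparr>"

definition residuated ::
  "'c sequent set \<Rightarrow> 'd sequent set \<Rightarrow> ('c sequent set \<Rightarrow> 'd sequent set) \<Rightarrow> bool" where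
  "residuated D E \<iota> \<longleftrightarrow>
     \<iota> \<in> Pow D \<rightarrow> Pow E \<and> (\<forall>X \<subseteq> Pow D. \<iota> (\<Union>X) = (\<Union>\<Phi>\<in>X. \<iota> \<Phi>))"

definition ns_interpretation ::
  "'c dsystem \<Rightarrow> 'd dsystem \<Rightarrow> ('c sequent set \<Rightarrow> 'd sequent set) \<Rightarrow> bool" where
  "ns_interpretation S T \<iota> \<longleftrightarrow>
     residuated (domain S) (domain T) \<iota> \<and>
     (\<forall>\<Phi> \<Psi>. \<Phi> \<subseteq> domain S \<longrightarrow> \<Psi> \<subseteq> domain S \<longrightarrow>
        (entails S \<Phi> \<Psi> \<longleftrightarrow> entails T (\<iota> \<Phi>) (\<iota> \<Psi>)))"

definition ns_nonconservative_interpretation ::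
  "'c dsystem \<Rightarrow> 'd dsystem \<Rightarrow> ('c sequent set \<Rightarrow> 'd sequent set) \<Rightarrow> bool" where
  "ns_nonconservative_interpretation S T \<iota> \<longleftrightarrow>
     residuated (domain S) (domain T) \<iota> \<and>
     (\<forall>\<Phi> \<Psi>. \<Phi> \<subseteq> domain S \<longrightarrow> \<Psi> \<subseteq> domain S \<longrightarrow>
        entails S \<Phi> \<Psi> \<longrightarrow> entails T (\<iota> \<Phi>) (\<iota> \<Psi>))"

text \<open>An extension is a substitution-invariant consequence relation on the same domain which is
  stronger than the given one. It need not be finitary: structural closure operators above
  \<open>closure_op T\<close> need not be finitary either, and it is these that extensions correspond to.\<close>

definition noncontradictory_extension ::
  "'c dsystem \<Rightarrow> ('c sequent set \<Rightarrow> 'c sequent set \<Rightarrow> bool) \<Rightarrow> bool" where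
  "noncontradictory_extension T E \<longleftrightarrow>
     consequence_relation (domain T) E \<and>
     substitution_invariant (language T) E \<and>
     (\<forall>\<Phi> \<Psi>. entails T \<Phi> \<Psi> \<longrightarrow> E \<Phi> \<Psi>) \<and>
     \<not> contradictory (T\<lparr>entails := E\<rparr>)"

definition ns_weak_interpretation ::
  "'c dsystem \<Rightarrow> 'd dsystem \<Rightarrow> ('c sequent set \<Rightarrow> 'd sequent set) \<Rightarrow> bool" where
  "ns_weak_interpretation S T \<iota> \<longleftrightarrow>
     (\<exists>E. noncontradictory_extension T E \<and> ns_interpretation S (T\<lparr>entails := E\<rparr>) \<iota>)"

definition ns_equivalent :: "'c dsystem \<Rightarrow> 'd dsystem \<Rightarrow> bool" where
  "ns_equivalent S T \<longleftrightarrow>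
     (\<exists>\<iota> \<iota>'. ns_interpretation S T \<iota> \<and> ns_interpretation T S \<iota>' \<and>
        (\<forall>\<Phi> \<subseteq> domain S. entails S \<Phi> ((\<iota>' \<circ> \<iota>) \<Phi>) \<and> entails S ((\<iota>' \<circ> \<iota>) \<Phi>) \<Phi>))"

end

theory Submission
  imports Defs
begin

text \<open>A deductive system is the same thing as its closure operator, since \<open>\<Phi> \<turnstile> \<Psi>\<close> iff
  \<open>\<Psi> \<subseteq> \<gamma> \<Phi>\<close>. An interpretation \<open>\<iota>\<close> induces the homomorphism \<open>x \<mapsto> \<delta> (\<iota> x)\<close> on theories.
  Conversely the powerset is the free sup-lattice on its points, so a homomorphism \<open>f\<close> lifts to
  the residuated map \<open>\<iota> \<Phi> = (\<Union>\<phi>\<in>\<Phi>. f (\<gamma> {\<phi>}))\<close>, which satisfies \<open>\<delta> (\<iota> \<Phi>) = f (\<gamma> \<Phi>)\<close>.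
  Conservativity of \<open>\<iota>\<close> then amounts to injectivity of \<open>f\<close>, and mutually inverse interpretations
  to mutually inverse homomorphisms.\<close>

section \<open>Closure operators on the powerset of a fixed set\<close>

text \<open>Structurality is left out: the lattice-theoretic arguments see only order and closure,
  so the same facts serve for \<open>closure_op\<close> and for an arbitrary \<epsilon>. Every axiom
  is relative to subsets of \<open>D\<close>, because values elsewhere are arbitrary.\<close>

locale powerset_closure =
  fixes D :: "'c sequent set" and c :: "'c sequent set \<Rightarrow> 'c sequent set"
  assumes closed_in: "\<Phi> \<subseteq> D \<Longrightarrow> c \<Phi> \<subseteq> D"
    and mono: "\<Psi> \<subseteq> D \<Longrightarrow> \<Phi> \<subseteq> \<Psi> \<Longrightarrow> c \<Phi> \<subseteq> c \<Psi>"
    and ext: "\<Phi> \<subseteq> D \<Longrightarrow> \<Phi> \<subseteq> c \<Phi>"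
    and idem: "\<Phi> \<subseteq> D \<Longrightarrow> c (c \<Phi>) = c \<Phi>"
begin

lemma closure_le_iff:
  assumes "\<Phi> \<subseteq> D" "\<Psi> \<subseteq> D"
  shows "c \<Psi> \<subseteq> c \<Phi> \<longleftrightarrow> \<Psi> \<subseteq> c \<Phi>"
proof
  show "c \<Psi> \<subseteq> c \<Phi> \<Longrightarrow> \<Psi> \<subseteq> c \<Phi>"
    using ext[OF assms(2)] by (rule subset_trans)
  show "c \<Psi> \<subseteq> c \<Phi>" if "\<Psi> \<subseteq> c \<Phi>"
    using mono[OF closed_in[OF assms(1)] that] idem[OF assms(1)] by (rule ord_le_eq_trans)
qed

text \<open>Joins of theories can therefore be computed from any generating sets. This is used in
  the target to see that an induced map preserves joins, and in the source to write a theory as the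
  join of the theories of its points.\<close>

lemma closure_UN_closure:
  assumes "\<And>i. i \<in> I \<Longrightarrow> A i \<subseteq> D"
  shows "c (\<Union>i\<in>I. c (A i)) = c (\<Union>i\<in>I. A i)"
proof
  have D: "(\<Union>i\<in>I. A i) \<subseteq> D" "(\<Union>i\<in>I. c (A i)) \<subseteq> D"
    by (intro UN_least closed_in assms; assumption)+
  have "(\<Union>i\<in>I. c (A i)) \<subseteq> c (\<Union>i\<in>I. A i)"
    by (intro UN_least mono[OF D(1)] UN_upper)
  then show "c (\<Union>i\<in>I. c (A i)) \<subseteq> c (\<Union>i\<in>I. A i)"
    by (rule iffD2[OF closure_le_iff[OF D]])
  show "c (\<Union>i\<in>I. A i) \<subseteq> c (\<Union>i\<in>I. c (A i))"
    by (intro mono[OF D(2)] UN_mono subset_refl ext assms)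
qed

text \<open>Expresses entailment as an equation between theories, the form in which an injective map
  can cancel it.\<close>

lemma closure_Un_eq_iff:
  assumes "\<Phi> \<subseteq> D" "\<Psi> \<subseteq> D"
  shows "c (\<Phi> \<union> \<Psi>) = c \<Phi> \<longleftrightarrow> \<Psi> \<subseteq> c \<Phi>"
proof -
  have D: "\<Phi> \<union> \<Psi> \<subseteq> D"
    using assms by (rule Un_least)
  have "c (\<Phi> \<union> \<Psi>) = c \<Phi> \<longleftrightarrow> c (\<Phi> \<union> \<Psi>) \<subseteq> c \<Phi>"
    by (rule iffI[OF equalityD1 equalityI[OF _ mono[OF D Un_upper1]]])
  also have "\<dots> \<longleftrightarrow> \<Phi> \<union> \<Psi> \<subseteq> c \<Phi>"
    using assms(1) D by (rule closure_le_iff)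
  also have "\<dots> \<longleftrightarrow> \<Psi> \<subseteq> c \<Phi>"
    by (simp only: Un_subset_iff ext[OF assms(1)] simp_thms)
  finally show ?thesis .
qed

end

lemma elems_theories [simp]: "elems (theories D c) = c ` Pow D"
  and Join_theories [simp]: "Join (theories D c) X = c (\<Union>X)"
  by (simp_all add: theories_def)

section \<open>Residuated maps versus homomorphisms of theories\<close>

lemma residuated_subset: "residuated D E \<iota> \<Longrightarrow> \<Phi> \<subseteq> D \<Longrightarrow> \<iota> \<Phi> \<subseteq> E"
  unfolding residuated_def by blast

lemma residuated_Union:
  "residuated D E \<iota> \<Longrightarrow> X \<subseteq> Pow D \<Longrightarrow> \<iota> (\<Union>X) = (\<Union>\<Phi>\<in>X. \<iota> \<Phi>)"
  unfolding residuated_def by blast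

text \<open>Monotonicity is preservation of the union of the two-element family
  \<open>{\<Phi>, \<Psi>}\<close>.\<close>

lemma residuated_mono:
  assumes "residuated D E \<iota>" "\<Psi> \<subseteq> D" "\<Phi> \<subseteq> \<Psi>"
  shows "\<iota> \<Phi> \<subseteq> \<iota> \<Psi>"
proof -
  have "\<iota> (\<Union>{\<Phi>, \<Psi>}) = (\<Union>x\<in>{\<Phi>, \<Psi>}. \<iota> x)"
    using assms by (intro residuated_Union) auto
  moreover have "\<Union>{\<Phi>, \<Psi>} = \<Psi>"
    using assms by auto
  ultimately show ?thesis
    by auto
qed

text \<open>The union is deliberately not closed: the lift then preserves unions exactly, whereas
  \<open>f\<close> only preserves joins of theories.\<close>

definition point_lift ::
  "('c sequent set \<Rightarrow> 'c sequent set) \<Rightarrow> ('c sequent set \<Rightarrow> 'd sequent set) \<Rightarrow>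
    'c sequent set \<Rightarrow> 'd sequent set" where
  "point_lift c f \<Phi> = (\<Union>\<phi>\<in>\<Phi>. f (c {\<phi>}))"

locale two_closures =
  source: powerset_closure D c + target: powerset_closure E d
  for D :: "'c sequent set" and c and E :: "'d sequent set" and d
begin

text \<open>Soundness at the strongest conclusion \<open>c \<Phi>\<close> makes
  \<open>d (\<iota> \<Phi>)\<close> depend on the theory of \<Phi> alone; monotonicity supplies the
  other inclusion.\<close>

lemma closure_residuated_closure:
  assumes \<iota>: "residuated D E \<iota>"
    and pres: "\<And>\<Phi>. \<Phi> \<subseteq> D \<Longrightarrow> \<iota> (c \<Phi>) \<subseteq> d (\<iota> \<Phi>)"
    and \<Phi>: "\<Phi> \<subseteq> D"
  shows "d (\<iota> (c \<Phi>)) = d (\<iota> \<Phi>)"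
proof
  have E: "\<iota> \<Phi> \<subseteq> E" "\<iota> (c \<Phi>) \<subseteq> E"
    using residuated_subset[OF \<iota>] \<Phi> source.closed_in by auto
  show "d (\<iota> (c \<Phi>)) \<subseteq> d (\<iota> \<Phi>)"
    using target.closure_le_iff E pres[OF \<Phi>] by blast
  show "d (\<iota> \<Phi>) \<subseteq> d (\<iota> (c \<Phi>))"
    by (intro target.mono E residuated_mono[OF \<iota>] source.closed_in source.ext \<Phi>)
qed

text \<open>A join of theories is the closure of their union. The inner closure \<open>c\<close> is
  absorbed, \<iota> distributes over the union, and \<open>d\<close> may then be inserted at each
  member.\<close>

lemma sup_hom_of_residuated:
  assumes \<iota>: "residuated D E \<iota>"
    and pres: "\<And>\<Phi>. \<Phi> \<subseteq> D \<Longrightarrow> \<iota> (c \<Phi>) \<subseteq> d (\<iota> \<Phi>)"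
  shows "sup_hom (theories D c) (theories E d) (\<lambda>x. d (\<iota> x))"
  unfolding sup_hom_def elems_theories Join_theories
proof (intro conjI allI impI)
  show "(\<lambda>x. d (\<iota> x)) \<in> c ` Pow D \<rightarrow> d ` Pow E"
    using residuated_subset[OF \<iota>] source.closed_in by blast
next
  fix X assume "X \<subseteq> c ` Pow D"
  then have X: "X \<subseteq> Pow D"
    using source.closed_in by blast
  then have "d (\<iota> (c (\<Union>X))) = d (\<iota> (\<Union>X))"
    by (intro closure_residuated_closure[OF \<iota> pres]) auto
  also have "\<dots> = d (\<Union>x\<in>X. \<iota> x)"
    using residuated_Union[OF \<iota> X] by simp
  also have "\<dots> = d (\<Union>x\<in>X. d (\<iota> x))"
    by (rule target.closure_UN_closure[symmetric]) (use X residuated_subset[OF \<iota>] in blast)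
  finally show "d (\<iota> (c (\<Union>X))) = d (\<Union>((\<lambda>x. d (\<iota> x)) ` X))" .
qed

lemma inj_on_of_conservative:
  assumes \<iota>: "residuated D E \<iota>"
    and conserv: "\<And>\<Phi> \<Psi>. \<Phi> \<subseteq> D \<Longrightarrow> \<Psi> \<subseteq> D \<Longrightarrow> \<iota> \<Psi> \<subseteq> d (\<iota> \<Phi>) \<Longrightarrow> \<Psi> \<subseteq> c \<Phi>"
  shows "inj_on (\<lambda>x. d (\<iota> x)) (c ` Pow D)"
proof (rule inj_onI)
  \<comment> \<open>The situation is symmetric in x and y, so one inclusion suffices.\<close>
  have le: "x \<subseteq> y" if "x \<in> c ` Pow D" "y \<in> c ` Pow D" "d (\<iota> x) = d (\<iota> y)" for x y
  proof -
    have xy: "x \<subseteq> D" "y \<subseteq> D" "c y = y"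
      using that source.closed_in source.idem by auto
    have "\<iota> x \<subseteq> d (\<iota> y)"
      using target.ext[OF residuated_subset[OF \<iota> xy(1)]] that(3) by simp
    then show ?thesis
      using conserv[OF xy(2,1)] xy(3) by simp
  qed
  fix x y assume "x \<in> c ` Pow D" "y \<in> c ` Pow D" "d (\<iota> x) = d (\<iota> y)"
  then show "x = y"
    by (intro equalityI le) simp_all
qed

context
  fixes f
  assumes hom: "sup_hom (theories D c) (theories E d) f"
begin

lemma hom_theory: "\<Phi> \<subseteq> D \<Longrightarrow> f (c \<Phi>) \<in> d ` Pow E"
  using hom unfolding sup_hom_def elems_theories by blast

lemma hom_theory_subset: "\<Phi> \<subseteq> D \<Longrightarrow> f (c \<Phi>) \<subseteq> E"
  using hom_theory[of \<Phi>] target.closed_in by auto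

lemma residuated_point_lift: "residuated D E (point_lift c f)"
  unfolding residuated_def point_lift_def using hom_theory_subset by blast

text \<open>The theory \<open>c \<Phi>\<close> is the join of the theories \<open>c {\<phi>}\<close>
  of its generators, and \<open>f\<close> carries this join to the join of the values that the lift
  unites.\<close>

lemma closure_point_lift:
  assumes \<Phi>: "\<Phi> \<subseteq> D"
  shows "d (point_lift c f \<Phi>) = f (c \<Phi>)"
proof -
  have "(\<lambda>\<phi>. c {\<phi>}) ` \<Phi> \<subseteq> c ` Pow D"
    using \<Phi> by blast
  then have "f (c (\<Union>\<phi>\<in>\<Phi>. c {\<phi>})) = d (\<Union>(f ` (\<lambda>\<phi>. c {\<phi>}) ` \<Phi>))"
    using hom unfolding sup_hom_def elems_theories Join_theories by blast
  moreover have "{\<phi>} \<subseteq> D" if "\<phi> \<in> \<Phi>" for \<phi>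
    using \<Phi> that by blast
  then have "c (\<Union>\<phi>\<in>\<Phi>. c {\<phi>}) = c \<Phi>"
    using source.closure_UN_closure[of \<Phi> "\<lambda>\<phi>. {\<phi>}"] by simp
  ultimately show ?thesis
    by (simp add: point_lift_def image_image)
qed

text \<open>The lift is monotone, and after closing it cannot tell \<open>c \<Phi>\<close> from
  \<Phi>.\<close>

lemma point_lift_preserves:
  assumes "\<Phi> \<subseteq> D" "\<Psi> \<subseteq> D" "\<Psi> \<subseteq> c \<Phi>"
  shows "point_lift c f \<Psi> \<subseteq> d (point_lift c f \<Phi>)"
proof -
  have "point_lift c f \<Psi> \<subseteq> point_lift c f (c \<Phi>)"
    using assms by (intro residuated_mono[OF residuated_point_lift] source.closed_in)
  also have "\<dots> \<subseteq> d (point_lift c f (c \<Phi>))"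
    using assms by (intro target.ext residuated_subset[OF residuated_point_lift] source.closed_in)
  also have "\<dots> = d (point_lift c f \<Phi>)"
    using assms by (simp add: closure_point_lift source.closed_in source.idem)
  finally show ?thesis .
qed

text \<open>An injective join-preserving map reflects the order, since the order of a sup-lattice is
  given by equations between joins.\<close>

lemma point_lift_conservative:
  assumes inj: "inj_on f (c ` Pow D)"
    and D: "\<Phi> \<subseteq> D" "\<Psi> \<subseteq> D"
    and le: "point_lift c f \<Psi> \<subseteq> d (point_lift c f \<Phi>)"
  shows "\<Psi> \<subseteq> c \<Phi>"
proof -
  let ?\<iota> = "point_lift c f"
  have "?\<iota> (\<Phi> \<union> \<Psi>) = ?\<iota> \<Phi> \<union> ?\<iota> \<Psi>"
    by (auto simp: point_lift_def)
  then have "d (?\<iota> (\<Phi> \<union> \<Psi>)) = d (?\<iota> \<Phi>)"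
    using target.closure_Un_eq_iff[of "?\<iota> \<Phi>" "?\<iota> \<Psi>"] le D
      residuated_subset[OF residuated_point_lift]
    by (simp only:)
  then have "f (c (\<Phi> \<union> \<Psi>)) = f (c \<Phi>)"
    using D by (simp add: closure_point_lift)
  then have "c (\<Phi> \<union> \<Psi>) = c \<Phi>"
    by (rule inj_onD[OF inj]) (use D in auto)
  then show ?thesis
    using source.closure_Un_eq_iff[OF D] by (rule iffD1[rotated])
qed

end

end

text \<open>Both sides of the claimed equation have the same image under \<open>f\<close>.
  Cancelling \<open>f\<close> requires the join to lie in the carrier, which the record type does
  not guarantee; hence the second hypothesis.\<close>

lemma sup_iso_inv:
  assumes iso: "sup_iso A B f"
    and Join_closed: "\<And>X. X \<subseteq> elems A \<Longrightarrow> Join A X \<in> elems A"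
  shows "sup_iso B A (inv_into (elems A) f)"
proof -
  let ?g = "inv_into (elems A) f"
  have bij: "bij_betw f (elems A) (elems B)"
    and hom: "\<And>X. X \<subseteq> elems A \<Longrightarrow> f (Join A X) = Join B (f ` X)"
    using iso by (auto simp: sup_iso_def sup_hom_def)
  have bij': "bij_betw ?g (elems B) (elems A)"
    by (rule bij_betw_inv_into[OF bij])
  have "?g (Join B Y) = Join A (?g ` Y)" if Y: "Y \<subseteq> elems B" for Y
  proof -
    have X: "?g ` Y \<subseteq> elems A"
      using bij' Y by (auto simp: bij_betw_def)
    have "f ` ?g ` Y = Y"
      using bij Y by (simp add: bij_betw_def image_inv_into_cancel)
    then have "f (Join A (?g ` Y)) = Join B Y"
      using hom[OF X] by simp
    then show ?thesis
      using inv_into_f_f[OF bij_betw_imp_inj_on[OF bij] Join_closed[OF X]] by simp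
  qed
  then show ?thesis
    using bij' bij_betwE[OF bij'] by (auto simp: sup_iso_def sup_hom_def)
qed

section \<open>From consequence relations to closure operators\<close>

lemma
  assumes "consequence_relation D R"
  shows consequence_relation_subset: "R \<Phi> \<Psi> \<Longrightarrow> \<Phi> \<subseteq> D \<and> \<Psi> \<subseteq> D"
    and consequence_relation_refl: "\<Phi> \<subseteq> D \<Longrightarrow> \<Psi> \<subseteq> \<Phi> \<Longrightarrow> R \<Phi> \<Psi>"
    and consequence_relation_trans: "R \<Phi> \<Psi> \<Longrightarrow> R \<Psi> \<Xi> \<Longrightarrow> R \<Phi> \<Xi>"
    and consequence_relation_Union: "\<Phi> \<subseteq> D \<Longrightarrow> R \<Phi> (\<Union>{\<Psi>. R \<Phi> \<Psi>})"
proof -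
  note D = assms[unfolded consequence_relation_def]
  show "R \<Phi> \<Psi> \<Longrightarrow> \<Phi> \<subseteq> D \<and> \<Psi> \<subseteq> D"
    using D[THEN conjunct1] by iprover
  show "\<Phi> \<subseteq> D \<Longrightarrow> \<Psi> \<subseteq> \<Phi> \<Longrightarrow> R \<Phi> \<Psi>"
    using D[THEN conjunct2, THEN conjunct1] by iprover
  show "R \<Phi> \<Psi> \<Longrightarrow> R \<Psi> \<Xi> \<Longrightarrow> R \<Phi> \<Xi>"
    by (rule D[THEN conjunct2, THEN conjunct2, THEN conjunct1, rule_format])
  show "\<Phi> \<subseteq> D \<Longrightarrow> R \<Phi> (\<Union>{\<Psi>. R \<Phi> \<Psi>})"
    by (rule D[THEN conjunct2, THEN conjunct2, THEN conjunct2, rule_format])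
qed

lemma entails_closure_op:
  "consequence_relation (domain S) (entails S) \<Longrightarrow> \<Phi> \<subseteq> domain S \<Longrightarrow>
    entails S \<Phi> (closure_op S \<Phi>)"
  unfolding closure_op_def by (rule consequence_relation_Union)

lemma closure_op_subset:
  assumes "consequence_relation (domain S) (entails S)"
  shows "closure_op S \<Phi> \<subseteq> domain S"
  unfolding closure_op_def using consequence_relation_subset[OF assms]
  by (intro Union_least) (simp only: mem_Collect_eq)

text \<open>Backwards, \<Phi> entails its whole closure, which entails each of its subsets. The
  guard on \<Phi> is essential: outside the domain the closure is an empty union, so the empty
  \<Psi> would slip through.\<close>

lemma entails_iff:
  assumes cr: "consequence_relation (domain S) (entails S)"
  shows "entails S \<Phi> \<Psi> \<longleftrightarrow> \<Phi> \<subseteq> domain S \<and> \<Psi> \<subseteq> closure_op S \<Phi>"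
proof
  assume "entails S \<Phi> \<Psi>"
  then show "\<Phi> \<subseteq> domain S \<and> \<Psi> \<subseteq> closure_op S \<Phi>"
    using consequence_relation_subset[OF cr, of \<Phi> \<Psi>] unfolding closure_op_def by blast
next
  assume "\<Phi> \<subseteq> domain S \<and> \<Psi> \<subseteq> closure_op S \<Phi>"
  then show "entails S \<Phi> \<Psi>"
    using consequence_relation_trans[OF cr entails_closure_op[OF cr]
        consequence_relation_refl[OF cr closure_op_subset[OF cr]]] by (elim conjE)
qed

lemma powerset_closure_closure_op:
  assumes cr: "consequence_relation (domain S) (entails S)"
  shows "powerset_closure (domain S) (closure_op S)"
proof
  note iff = entails_iff[OF cr] and trans = consequence_relation_trans[OF cr]
    and refl = consequence_relation_refl[OF cr] and closed = closure_op_subset[OF cr]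
  show "closure_op S \<Phi> \<subseteq> domain S" for \<Phi>
    by (rule closed)
  show ext: "\<Phi> \<subseteq> closure_op S \<Phi>" if "\<Phi> \<subseteq> domain S" for \<Phi>
    using refl[OF that subset_refl] unfolding iff by (rule conjunct2)
  show "closure_op S \<Phi> \<subseteq> closure_op S \<Psi>" if "\<Psi> \<subseteq> domain S" "\<Phi> \<subseteq> \<Psi>" for \<Phi> \<Psi>
    using trans[OF refl[OF that] entails_closure_op[OF cr subset_trans[OF that(2,1)]]]
    unfolding iff by (rule conjunct2)
  show "closure_op S (closure_op S \<Phi>) = closure_op S \<Phi>" if "\<Phi> \<subseteq> domain S" for \<Phi>
  proof
    show "closure_op S (closure_op S \<Phi>) \<subseteq> closure_op S \<Phi>"
      using trans[OF entails_closure_op[OF cr that] entails_closure_op[OF cr closed]]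
      unfolding iff by (rule conjunct2)
  qed (rule ext[OF closed])
qed

lemma contradictory_iff:
  assumes cr: "consequence_relation (domain S) (entails S)"
  shows "contradictory S \<longleftrightarrow> (\<forall>\<Phi> \<subseteq> domain S. closure_op S \<Phi> = domain S)"
proof
  assume "contradictory S"
  then show "\<forall>\<Phi> \<subseteq> domain S. closure_op S \<Phi> = domain S"
    unfolding contradictory_def entails_iff[OF cr]
    by (intro allI impI equalityI closure_op_subset[OF cr]) (meson subset_refl)
next
  assume "\<forall>\<Phi> \<subseteq> domain S. closure_op S \<Phi> = domain S"
  then show "contradictory S"
    unfolding contradictory_def entails_iff[OF cr] by simp
qed

text \<open>Invariance speaks of one substitution at a time, but \<Sigma> \<star> \<Phi> is the
  union of the images of \<Phi>, and the closure of each image lies below the closure of the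
  union.\<close>

lemma structural_closure_operator_closure_op:
  assumes cr: "consequence_relation (domain S) (entails S)"
    and si: "substitution_invariant (language S) (entails S)"
  shows "structural_closure_operator (language S) (domain S) (closure_op S)"
proof -
  interpret powerset_closure "domain S" "closure_op S"
    by (rule powerset_closure_closure_op[OF cr])
  note iff = entails_iff[OF cr]
  have inv: "entails S (subst_seq \<sigma> ` \<Phi>) (subst_seq \<sigma> ` \<Psi>)"
    if "\<sigma> \<in> substs (language S)" "entails S \<Phi> \<Psi>" for \<sigma> \<Phi> \<Psi>
    using si that unfolding substitution_invariant_def by (iprover dest: bspec)
  have "\<Sigma> \<star> closure_op S \<Phi> \<subseteq> closure_op S (\<Sigma> \<star> \<Phi>)"
    if \<Sigma>: "\<Sigma> \<subseteq> substs (language S)" and \<Phi>: "\<Phi> \<subseteq> domain S" for \<Sigma> \<Phi>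
  proof -
    \<comment> \<open>Both facts come from substituting in the entailment of
      \<open>closure_op S \<Phi>\<close> from \<Phi>; the first because only subsets of the domain
      are related.\<close>
    have image: "subst_seq \<sigma> ` \<Phi> \<subseteq> domain S"
        "subst_seq \<sigma> ` closure_op S \<Phi> \<subseteq> closure_op S (subst_seq \<sigma> ` \<Phi>)" if "\<sigma> \<in> \<Sigma>" for \<sigma>
      using inv[OF subsetD[OF \<Sigma> that] entails_closure_op[OF cr \<Phi>]] unfolding iff
      by (rule conjunct1, rule conjunct2)
    have star: "\<Sigma> \<star> \<Xi> = (\<Union>\<sigma>\<in>\<Sigma>. subst_seq \<sigma> ` \<Xi>)" for \<Xi>
      unfolding star_def by blast
    have "\<Sigma> \<star> \<Phi> \<subseteq> domain S"
      unfolding star by (intro UN_least image)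
    then have "closure_op S (subst_seq \<sigma> ` \<Phi>) \<subseteq> closure_op S (\<Sigma> \<star> \<Phi>)" if "\<sigma> \<in> \<Sigma>" for \<sigma>
      by (rule mono) (unfold star, rule UN_upper[OF that])
    then show ?thesis
      unfolding star[of "closure_op S \<Phi>"] by (intro UN_least subset_trans[OF image(2)])
  qed
  then show ?thesis
    unfolding structural_closure_operator_def using closed_in mono ext idem
    by (intro conjI allI impI funcsetI PowI; simp only: Pow_iff)
qed

section \<open>From closure operators back to consequence relations\<close>

text \<open>The first conjunct is a guard: outside the powerset of \<open>D\<close> the values of
  \<open>c\<close> are unconstrained.\<close>

definition entails_of ::
  "'c sequent set \<Rightarrow> ('c sequent set \<Rightarrow> 'c sequent set) \<Rightarrow>
    'c sequent set \<Rightarrow> 'c sequent set \<Rightarrow> bool" where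
  "entails_of D c \<Phi> \<Psi> \<longleftrightarrow> \<Phi> \<subseteq> D \<and> \<Psi> \<subseteq> c \<Phi>"

lemma Union_entails_of: "\<Phi> \<subseteq> D \<Longrightarrow> \<Union>{\<Psi>. entails_of D c \<Phi> \<Psi>} = c \<Phi>"
  unfolding entails_of_def by blast

lemma (in powerset_closure) consequence_relation_entails_of:
  "consequence_relation D (entails_of D c)"
  unfolding consequence_relation_def
proof (intro conjI allI impI)
  fix \<Phi> \<Psi> \<Xi> assume "entails_of D c \<Phi> \<Psi>" "entails_of D c \<Psi> \<Xi>"
  then show "entails_of D c \<Phi> \<Xi>"
    using closed_in[of \<Phi>] closure_le_iff[of \<Phi> \<Psi>] unfolding entails_of_def
    by (meson subset_trans)
next
  fix \<Phi> assume "\<Phi> \<subseteq> D"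
  then show "entails_of D c \<Phi> (\<Union>{\<Psi>. entails_of D c \<Phi> \<Psi>})"
    using Union_entails_of[of \<Phi> D c] unfolding entails_of_def by simp
next
  fix \<Phi> \<Psi> assume "entails_of D c \<Phi> \<Psi>"
  then show "\<Phi> \<subseteq> D" "\<Psi> \<subseteq> D"
    using closed_in[of \<Phi>] unfolding entails_of_def by auto
next
  fix \<Phi> \<Psi> assume "\<Phi> \<subseteq> D" "\<Psi> \<subseteq> \<Phi>"
  then show "entails_of D c \<Phi> \<Psi>"
    using ext[of \<Phi>] unfolding entails_of_def by auto
qed

lemma powerset_closure_structural:
  "structural_closure_operator L D \<epsilon> \<Longrightarrow> powerset_closure D \<epsilon>"
  unfolding structural_closure_operator_def powerset_closure_def Pi_iff Ball_def Pow_iff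
  by iprover

text \<open>Invariance applied to the reflexive entailment of \<Phi> from itself replaces an
  induction on formulas together with closure under type.\<close>

lemma subst_seq_in_domain:
  assumes "deductive_system S" "\<sigma> \<in> substs (language S)" "\<Phi> \<subseteq> domain S"
  shows "subst_seq \<sigma> ` \<Phi> \<subseteq> domain S"
proof -
  have cr: "consequence_relation (domain S) (entails S)"
    and "substitution_invariant (language S) (entails S)"
    using assms(1) unfolding deductive_system_def by auto
  then have "entails S (subst_seq \<sigma> ` \<Phi>) (subst_seq \<sigma> ` \<Phi>)"
    using consequence_relation_refl[OF cr assms(3) subset_refl] assms(2)
    unfolding substitution_invariant_def by (iprover dest: bspec)
  then show ?thesis
    using consequence_relation_subset[OF cr] by iprover
qed

lemma substitution_invariant_entails_of:
  assumes ds: "deductive_system S"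
    and \<epsilon>: "structural_closure_operator (language S) (domain S) \<epsilon>"
  shows "substitution_invariant (language S) (entails_of (domain S) \<epsilon>)"
  unfolding substitution_invariant_def
proof (intro ballI allI impI)
  fix \<sigma> \<Phi> \<Psi>
  assume \<sigma>: "\<sigma> \<in> substs (language S)" and ent: "entails_of (domain S) \<epsilon> \<Phi> \<Psi>"
  \<comment> \<open>Invariance under \<sigma> is structurality for the singleton
    \<open>{\<sigma>}\<close>.\<close>
  have star: "{\<sigma>} \<star> \<Xi> = subst_seq \<sigma> ` \<Xi>" for \<Xi>
    unfolding star_def by blast
  have "\<Phi> \<subseteq> domain S"
    using ent by (simp add: entails_of_def)
  moreover have "{\<sigma>} \<subseteq> substs (language S)"
    using \<sigma> by simp
  ultimately have "{\<sigma>} \<star> \<epsilon> \<Phi> \<subseteq> \<epsilon> ({\<sigma>} \<star> \<Phi>)"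
    using \<epsilon> unfolding structural_closure_operator_def by meson
  then show "entails_of (domain S) \<epsilon> (subst_seq \<sigma> ` \<Phi>) (subst_seq \<sigma> ` \<Psi>)"
    using subst_seq_in_domain[OF ds \<sigma>, of \<Phi>] ent unfolding star entails_of_def by blast
qed

section \<open>Interpretations between two consequence relations\<close>

text \<open>Finitarity is not assumed, so that the target can also be an extension of
  \<open>T\<close>, which may fail to be finitary.\<close>

locale two_consequences =
  fixes S :: "'c dsystem" and T :: "'d dsystem"
  assumes cr_S: "consequence_relation (domain S) (entails S)"
    and cr_T: "consequence_relation (domain T) (entails T)"
begin

sublocale two_closures "domain S" "closure_op S" "domain T" "closure_op T"
  by (intro two_closures.intro powerset_closure_closure_op cr_S cr_T)

lemma nonconservative_iff:
  "ns_nonconservative_interpretation S T \<iota> \<longleftrightarrow>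
     residuated (domain S) (domain T) \<iota> \<and>
     (\<forall>\<Phi> \<Psi>. \<Phi> \<subseteq> domain S \<longrightarrow> \<Psi> \<subseteq> domain S \<longrightarrow>
        \<Psi> \<subseteq> closure_op S \<Phi> \<longrightarrow> \<iota> \<Psi> \<subseteq> closure_op T (\<iota> \<Phi>))"
  unfolding ns_nonconservative_interpretation_def entails_iff[OF cr_S] entails_iff[OF cr_T]
  \<comment> \<open>With \<open>conj_cong\<close>, residuation of \<iota> is available for the
    second conjunct and discharges the guard on \<open>\<iota> \<Phi>\<close> coming from
    \<open>entails_iff\<close>.\<close>
  by (rule conj_cong) (simp_all add: residuated_subset[of "domain S" "domain T" \<iota>])

lemma interpretation_iff:
  "ns_interpretation S T \<iota> \<longleftrightarrow>
     residuated (domain S) (domain T) \<iota> \<and>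
     (\<forall>\<Phi> \<Psi>. \<Phi> \<subseteq> domain S \<longrightarrow> \<Psi> \<subseteq> domain S \<longrightarrow>
        (\<Psi> \<subseteq> closure_op S \<Phi> \<longleftrightarrow> \<iota> \<Psi> \<subseteq> closure_op T (\<iota> \<Phi>)))"
  unfolding ns_interpretation_def entails_iff[OF cr_S] entails_iff[OF cr_T]
  by (rule conj_cong) (simp_all add: residuated_subset[of "domain S" "domain T" \<iota>])

lemma sup_hom_of_nonconservative:
  assumes "ns_nonconservative_interpretation S T \<iota>"
  shows "sup_hom (theories (domain S) (closure_op S)) (theories (domain T) (closure_op T))
    (\<lambda>x. closure_op T (\<iota> x))"
proof (rule sup_hom_of_residuated)
  show "residuated (domain S) (domain T) \<iota>"
    using assms unfolding nonconservative_iff by simp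
  show "\<iota> (closure_op S \<Phi>) \<subseteq> closure_op T (\<iota> \<Phi>)" if "\<Phi> \<subseteq> domain S" for \<Phi>
    using assms that source.closed_in[OF that] unfolding nonconservative_iff by simp
qed

lemma nonconservative_point_lift:
  assumes "sup_hom (theories (domain S) (closure_op S)) (theories (domain T) (closure_op T)) f"
  shows "ns_nonconservative_interpretation S T (point_lift (closure_op S) f)"
  unfolding nonconservative_iff
  by (intro conjI allI impI residuated_point_lift[OF assms] point_lift_preserves[OF assms])

lemma nonconservative_of_interpretation:
  "ns_interpretation S T \<iota> \<Longrightarrow> ns_nonconservative_interpretation S T \<iota>"
  unfolding ns_interpretation_def ns_nonconservative_interpretation_def by simp

lemma inj_on_of_interpretation:
  assumes "ns_interpretation S T \<iota>"
  shows "inj_on (\<lambda>x. closure_op T (\<iota> x)) (closure_op S ` Pow (domain S))"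
proof (rule inj_on_of_conservative)
  show "residuated (domain S) (domain T) \<iota>"
    using assms unfolding interpretation_iff by simp
  show "\<Psi> \<subseteq> closure_op S \<Phi>"
    if "\<Phi> \<subseteq> domain S" "\<Psi> \<subseteq> domain S" "\<iota> \<Psi> \<subseteq> closure_op T (\<iota> \<Phi>)" for \<Phi> \<Psi>
    using assms that unfolding interpretation_iff by simp
qed

lemma interpretation_point_lift:
  assumes "sup_hom (theories (domain S) (closure_op S)) (theories (domain T) (closure_op T)) f"
    and "inj_on f (closure_op S ` Pow (domain S))"
  shows "ns_interpretation S T (point_lift (closure_op S) f)"
  unfolding interpretation_iff
proof (intro conjI allI impI)
  show "\<Psi> \<subseteq> closure_op S \<Phi> \<longleftrightarrow>
      point_lift (closure_op S) f \<Psi> \<subseteq> closure_op T (point_lift (closure_op S) f \<Phi>)"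
    if "\<Phi> \<subseteq> domain S" "\<Psi> \<subseteq> domain S" for \<Phi> \<Psi>
    using point_lift_preserves[OF assms(1) that] point_lift_conservative[OF assms that] by (rule iffI)
qed (rule residuated_point_lift[OF assms(1)])

text \<open>The homomorphism induced by \<iota> is injective by conservativity, so surjectivity
  remains: a theory y is the image of the theory generated by \<open>\<iota>' y\<close>.\<close>

lemma sup_iso_of_equivalent:
  assumes "ns_equivalent S T"
  shows "\<exists>f. sup_iso (theories (domain S) (closure_op S)) (theories (domain T) (closure_op T)) f"
proof -
  obtain \<iota> \<iota>' where \<iota>: "ns_interpretation S T \<iota>" and \<iota>': "ns_interpretation T S \<iota>'"
    and inv: "\<And>\<Phi>. \<Phi> \<subseteq> domain S \<Longrightarrow> entails S \<Phi> (\<iota>' (\<iota> \<Phi>)) \<and> entails S (\<iota>' (\<iota> \<Phi>)) \<Phi>"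
    using assms unfolding ns_equivalent_def by auto
  let ?f = "\<lambda>x. closure_op T (\<iota> x)"
  have res: "residuated (domain S) (domain T) \<iota>" "residuated (domain T) (domain S) \<iota>'"
    using \<iota> \<iota>' unfolding ns_interpretation_def by auto
  have "y \<in> ?f ` closure_op S ` Pow (domain S)" if y: "y \<in> closure_op T ` Pow (domain T)" for y
  proof -
    obtain \<Psi> where \<Psi>: "\<Psi> \<subseteq> domain T" "y = closure_op T \<Psi>"
      using y by blast
    then have yT: "y \<subseteq> domain T" "closure_op T y = y"
      using target.closed_in[OF \<Psi>(1)] target.idem[OF \<Psi>(1)] by simp_all
    let ?x = "\<iota>' y"
    have x: "?x \<subseteq> domain S"
      using residuated_subset[OF res(2) yT(1)] .
    then have \<iota>x: "\<iota> ?x \<subseteq> domain T"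
      by (rule residuated_subset[OF res(1)])
    \<comment> \<open>Only \<open>\<iota>' \<circ> \<iota>\<close> is assumed to be inverse; conservativity of \<open>\<iota>'\<close> transfers this to \<open>\<iota> \<circ> \<iota>'\<close>.\<close>
    have "entails T y (\<iota> ?x)" "entails T (\<iota> ?x) y"
      using inv[OF x] \<iota>' yT(1) \<iota>x unfolding ns_interpretation_def by simp_all
    then have "\<iota> ?x \<subseteq> closure_op T y" "y \<subseteq> closure_op T (\<iota> ?x)"
      unfolding entails_iff[OF cr_T] by simp_all
    then have "closure_op T (\<iota> ?x) = closure_op T y"
      by (intro equalityI iffD2[OF target.closure_le_iff] yT(1) \<iota>x)
    moreover have "\<iota> (closure_op S \<Phi>) \<subseteq> closure_op T (\<iota> \<Phi>)" if "\<Phi> \<subseteq> domain S" for \<Phi>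
      using nonconservative_of_interpretation[OF \<iota>] that source.closed_in[OF that]
      unfolding nonconservative_iff by simp
    then have "closure_op T (\<iota> (closure_op S ?x)) = closure_op T (\<iota> ?x)"
      by (rule closure_residuated_closure[OF res(1) _ x])
    ultimately have "y = ?f (closure_op S ?x)"
      by (simp only: yT(2))
    then show ?thesis
      by (rule image_eqI) (intro imageI PowI x)
  qed
  moreover have hom: "sup_hom (theories (domain S) (closure_op S))
      (theories (domain T) (closure_op T)) ?f"
    by (intro sup_hom_of_nonconservative nonconservative_of_interpretation \<iota>)
  ultimately have "bij_betw ?f (closure_op S ` Pow (domain S)) (closure_op T ` Pow (domain T))"
    using inj_on_of_interpretation[OF \<iota>] unfolding bij_betw_def sup_hom_def elems_theories
    by blast
  then show ?thesis
    using hom unfolding sup_iso_def elems_theories by blast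
qed

text \<open>The lifts of \<open>f\<close> and of its inverse need not be inverse as maps of sets.
  They are inverse after closing, which is exactly mutual derivability.\<close>

lemma equivalent_of_sup_iso:
  assumes iso: "sup_iso (theories (domain S) (closure_op S)) (theories (domain T) (closure_op T)) f"
  shows "ns_equivalent S T"
proof -
  interpret flip: two_consequences T S
    by (intro two_consequences.intro cr_S cr_T)
  let ?g = "inv_into (closure_op S ` Pow (domain S)) f"
  let ?\<iota> = "point_lift (closure_op S) f" and ?\<iota>' = "point_lift (closure_op T) ?g"
  have "Join (theories (domain S) (closure_op S)) X \<in> elems (theories (domain S) (closure_op S))"
    if "X \<subseteq> elems (theories (domain S) (closure_op S))" for X
  proof -
    have "\<Union>X \<subseteq> domain S"
      using that closure_op_subset[OF cr_S] by (intro Union_least) auto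
    then show ?thesis
      by simp
  qed
  then have iso': "sup_iso (theories (domain T) (closure_op T)) (theories (domain S) (closure_op S)) ?g"
    using sup_iso_inv[OF iso] by simp
  have hom: "sup_hom (theories (domain S) (closure_op S)) (theories (domain T) (closure_op T)) f"
      "sup_hom (theories (domain T) (closure_op T)) (theories (domain S) (closure_op S)) ?g"
    and inj: "inj_on f (closure_op S ` Pow (domain S))"
      "inj_on ?g (closure_op T ` Pow (domain T))"
    using iso iso' unfolding sup_iso_def bij_betw_def elems_theories by blast+
  have \<iota>: "ns_interpretation S T ?\<iota>" and \<iota>': "ns_interpretation T S ?\<iota>'"
    by (rule interpretation_point_lift[OF hom(1) inj(1)],
        rule flip.interpretation_point_lift[OF hom(2) inj(2)])
  have "entails S \<Phi> (?\<iota>' (?\<iota> \<Phi>)) \<and> entails S (?\<iota>' (?\<iota> \<Phi>)) \<Phi>" if \<Phi>: "\<Phi> \<subseteq> domain S" for \<Phi>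
  proof -
    have \<iota>\<Phi>: "?\<iota> \<Phi> \<subseteq> domain T"
      using residuated_point_lift[OF hom(1)] \<Phi> by (rule residuated_subset)
    with flip.residuated_point_lift[OF hom(2)] have \<iota>\<iota>\<Phi>: "?\<iota>' (?\<iota> \<Phi>) \<subseteq> domain S"
      by (rule residuated_subset)
    have "closure_op S (?\<iota>' (?\<iota> \<Phi>)) = ?g (f (closure_op S \<Phi>))"
      using flip.closure_point_lift[OF hom(2) \<iota>\<Phi>] closure_point_lift[OF hom(1) \<Phi>] by simp
    also have "\<dots> = closure_op S \<Phi>"
      using inv_into_f_f[OF inj(1)] \<Phi> by blast
    finally show ?thesis
      using source.ext[OF \<Phi>] source.ext[OF \<iota>\<iota>\<Phi>] \<Phi> \<iota>\<iota>\<Phi> unfolding entails_iff[OF cr_S] by simp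
  qed
  then show ?thesis
    using \<iota> \<iota>' unfolding ns_equivalent_def by auto
qed

end

section \<open>Weak interpretations and the main equivalences\<close>

text \<open>The witness for \<epsilon> is the closure operator of the extension; it lies above that
  of \<open>T\<close> because a stronger relation unites more sets.\<close>

lemma embedding_of_weak_interpretation:
  assumes S: "deductive_system S" and T: "deductive_system T"
    and weak: "ns_weak_interpretation S T \<iota>"
  shows "\<exists>\<epsilon> f. structural_closure_operator (language T) (domain T) \<epsilon> \<and>
      (\<forall>\<Phi> \<subseteq> domain T. closure_op T \<Phi> \<subseteq> \<epsilon> \<Phi>) \<and>
      sup_hom (theories (domain S) (closure_op S)) (theories (domain T) \<epsilon>) f \<and>
      inj_on f (elems (theories (domain S) (closure_op S)))"
proof -
  obtain E where E: "noncontradictory_extension T E"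
    and \<iota>: "ns_interpretation S (T\<lparr>entails := E\<rparr>) \<iota>"
    using weak unfolding ns_weak_interpretation_def by blast
  let ?T' = "T\<lparr>entails := E\<rparr>"
  interpret two_consequences S ?T'
    using S E by unfold_locales (auto simp: deductive_system_def noncontradictory_extension_def)
  have "structural_closure_operator (language T) (domain T) (closure_op ?T')"
    using structural_closure_operator_closure_op[of ?T'] E
    by (simp add: noncontradictory_extension_def)
  moreover have "closure_op T \<Phi> \<subseteq> closure_op ?T' \<Phi>" for \<Phi>
    using E unfolding noncontradictory_extension_def closure_op_def by auto
  ultimately show ?thesis
    using sup_hom_of_nonconservative[OF nonconservative_of_interpretation[OF \<iota>]]
      inj_on_of_interpretation[OF \<iota>] by auto
qed

text \<open>The extension is read off from \<epsilon>. That \<open>S\<close> is not contradictory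
  prevents \<epsilon> from being trivial, as \<open>f\<close> is injective.\<close>

lemma weak_interpretation_of_embedding:
  assumes S: "deductive_system S" and T: "deductive_system T"
    and noncontr: "\<not> contradictory S"
    and \<epsilon>: "structural_closure_operator (language T) (domain T) \<epsilon>"
    and ge: "\<And>\<Phi>. \<Phi> \<subseteq> domain T \<Longrightarrow> closure_op T \<Phi> \<subseteq> \<epsilon> \<Phi>"
    and hom: "sup_hom (theories (domain S) (closure_op S)) (theories (domain T) \<epsilon>) f"
    and inj: "inj_on f (closure_op S ` Pow (domain S))"
  shows "\<exists>\<iota>. ns_weak_interpretation S T \<iota>"
proof -
  let ?E = "entails_of (domain T) \<epsilon>"
  let ?T' = "T\<lparr>entails := ?E\<rparr>"
  interpret \<epsilon>: powerset_closure "domain T" \<epsilon>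
    by (rule powerset_closure_structural[OF \<epsilon>])
  have cr: "consequence_relation (domain S) (entails S)"
      "consequence_relation (domain T) (entails T)"
    using S T unfolding deductive_system_def by auto
  interpret two_consequences S ?T'
    using cr(1) \<epsilon>.consequence_relation_entails_of by unfold_locales auto
  have cl: "closure_op ?T' \<Phi> = \<epsilon> \<Phi>" if "\<Phi> \<subseteq> domain T" for \<Phi>
    using Union_entails_of[OF that] by (simp add: closure_op_def)
  \<comment> \<open>The operators \<epsilon> and \<open>closure_op ?T'\<close> are only known to
    agree on subsets of the domain, so each argument occurring in the definition of homomorphism has
    to be located there.\<close>
  have hom': "sup_hom (theories (domain S) (closure_op S)) (theories (domain ?T') (closure_op ?T')) f"
  proof -
    have f: "f \<in> closure_op S ` Pow (domain S) \<rightarrow> \<epsilon> ` Pow (domain T)"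
      using hom unfolding sup_hom_def elems_theories by (rule conjunct1)
    have "closure_op ?T' ` Pow (domain T) = \<epsilon> ` Pow (domain T)"
      using cl by (intro image_cong) auto
    moreover have "closure_op ?T' (\<Union>(f ` X)) = \<epsilon> (\<Union>(f ` X))"
      if "X \<subseteq> closure_op S ` Pow (domain S)" for X
    proof (rule cl)
      show "\<Union>(f ` X) \<subseteq> domain T"
      proof (rule Union_least)
        fix y assume "y \<in> f ` X"
        then have "y \<in> \<epsilon> ` Pow (domain T)"
          using f that by blast
        then show "y \<subseteq> domain T"
          by (rule imageE) (simp add: \<epsilon>.closed_in)
      qed
    qed
    ultimately show ?thesis
      using hom unfolding sup_hom_def by simp
  qed
  \<comment> \<open>A contradictory extension has a single theory; injectivity of \<open>f\<close>
    would leave \<open>S\<close> only one theory as well, namely its whole domain.\<close>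
  have "\<not> contradictory ?T'"
  proof
    assume "contradictory ?T'"
    then have triv: "\<epsilon> \<Phi> = domain T" if "\<Phi> \<subseteq> domain T" for \<Phi>
      using contradictory_iff[OF cr_T] cl[OF that] that by simp
    have f: "f (closure_op S \<Phi>) = domain T" if "\<Phi> \<subseteq> domain S" for \<Phi>
    proof -
      have "f (closure_op S \<Phi>) \<in> \<epsilon> ` Pow (domain T)"
        using hom that unfolding sup_hom_def elems_theories by blast
      then show ?thesis
        using triv by auto
    qed
    have "closure_op S \<Phi> = closure_op S (domain S)" if "\<Phi> \<subseteq> domain S" for \<Phi>
      by (rule inj_onD[OF inj]) (use that f[OF that] f[OF subset_refl] in auto)
    moreover have "closure_op S (domain S) = domain S"
      by (intro equalityI source.ext closure_op_subset[OF cr(1)] subset_refl)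
    ultimately show False
      using noncontr contradictory_iff[OF cr(1)] by simp
  qed
  moreover have "?E \<Phi> \<Psi>" if "entails T \<Phi> \<Psi>" for \<Phi> \<Psi>
    using that ge[of \<Phi>] unfolding entails_iff[OF cr(2)] entails_of_def by blast
  ultimately have "noncontradictory_extension T ?E"
    using \<epsilon>.consequence_relation_entails_of substitution_invariant_entails_of[OF T \<epsilon>]
    unfolding noncontradictory_extension_def by blast
  then show ?thesis
    using interpretation_point_lift[OF hom' inj] unfolding ns_weak_interpretation_def by blast
qed

\<comment> \<open>The case in which the extension given by \<open>\<epsilon>\<close> may be contradictory, so that \<open>\<epsilon>\<close> has to be
  discarded.\<close>
lemma weak_interpretation_of_contradictory:
  assumes "deductive_system T" and "contradictory S" and "\<not> contradictory T"
  shows "ns_weak_interpretation S T (\<lambda>_. {})"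
proof -
  have "noncontradictory_extension T (entails T)"
    using assms unfolding deductive_system_def noncontradictory_extension_def by simp
  moreover have "entails T {} {}"
    using assms unfolding deductive_system_def consequence_relation_def by blast
  then have "ns_interpretation S (T\<lparr>entails := entails T\<rparr>) (\<lambda>_. {})"
    using assms unfolding ns_interpretation_def residuated_def contradictory_def by simp
  ultimately show ?thesis
    unfolding ns_weak_interpretation_def by blast
qed

theorem corollary5p6p5:
  fixes S :: "'c dsystem" and T :: "'d dsystem"
  assumes "deductive_system S" and "deductive_system T"
    and "\<exists>\<Phi> \<subseteq> domain S. closure_op S \<Phi> \<noteq> \<Phi>"
    and "\<exists>\<Phi> \<subseteq> domain T. closure_op T \<Phi> \<noteq> \<Phi>"
  shows "((\<exists>\<iota>. ns_nonconservative_interpretation S T \<iota>) \<longleftrightarrow>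
           (\<exists>f. sup_hom (theories (domain S) (closure_op S)) (theories (domain T) (closure_op T)) f))
    \<and> (\<not> (contradictory S \<and> contradictory T) \<longrightarrow>
        ((\<exists>\<iota>. ns_weak_interpretation S T \<iota>) \<longleftrightarrow>
           (\<exists>\<epsilon> f. structural_closure_operator (language T) (domain T) \<epsilon> \<and>
              (\<forall>\<Phi> \<subseteq> domain T. closure_op T \<Phi> \<subseteq> \<epsilon> \<Phi>) \<and>
              sup_hom (theories (domain S) (closure_op S)) (theories (domain T) \<epsilon>) f \<and>
              inj_on f (elems (theories (domain S) (closure_op S))))))
    \<and> (ns_equivalent S T \<longleftrightarrow>
           (\<exists>f. sup_iso (theories (domain S) (closure_op S)) (theories (domain T) (closure_op T)) f))"
proof -
  interpret two_consequences S T
    using assms(1,2) by unfold_locales (auto simp: deductive_system_def)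
  have "(\<exists>\<iota>. ns_nonconservative_interpretation S T \<iota>) \<longleftrightarrow>
      (\<exists>f. sup_hom (theories (domain S) (closure_op S)) (theories (domain T) (closure_op T)) f)"
    using sup_hom_of_nonconservative nonconservative_point_lift by blast
  moreover have "(\<exists>\<iota>. ns_weak_interpretation S T \<iota>) \<longleftrightarrow>
      (\<exists>\<epsilon> f. structural_closure_operator (language T) (domain T) \<epsilon> \<and>
        (\<forall>\<Phi> \<subseteq> domain T. closure_op T \<Phi> \<subseteq> \<epsilon> \<Phi>) \<and>
        sup_hom (theories (domain S) (closure_op S)) (theories (domain T) \<epsilon>) f \<and>
        inj_on f (elems (theories (domain S) (closure_op S))))"
    (is "?weak \<longleftrightarrow> ?embed") if "\<not> (contradictory S \<and> contradictory T)"
  proof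
    show "?weak \<Longrightarrow> ?embed"
      using embedding_of_weak_interpretation[OF assms(1,2)] by blast
    \<comment> \<open>If \<open>S\<close> is contradictory then \<open>T\<close> is not, and the
      constant empty map serves; otherwise the embedding itself is lifted.\<close>
    show "?embed \<Longrightarrow> ?weak"
      using weak_interpretation_of_contradictory[OF assms(2)]
        weak_interpretation_of_embedding[OF assms(1,2)] that
      unfolding elems_theories by meson
  qed
  moreover have "ns_equivalent S T \<longleftrightarrow>
      (\<exists>f. sup_iso (theories (domain S) (closure_op S)) (theories (domain T) (closure_op T)) f)"
    using sup_iso_of_equivalent equivalent_of_sup_iso by blast
  ultimately show ?thesis
    by blast
qed

end
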